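(* Let $M\ge 1$ be an integer and let ${\bf T}=\{\tau_1,\dots,\tau_N\}$ be a sporadic task set with arbitrary deadlines, indexed so that $D_1\le D_2\le\cdots\le D_N$. Run the deadline-monotonic partitioning algorithm on ${\bf T}$ with $M$ unit-speed processors, using as per-processor test the following condition for assigning $\tau_k$ to a processor currently holding ${\bf T}_m$: $$C_k+\sum_{\tau_i\in{\bf T}_m}\Big(1+\frac{D_k}{T_i}\Big)C_i\le D_k\quad\text{and}\quad U_k+\sum_{\tau_i\in{\bf T}_m}U_i\le 1,$$ and using any fitting strategy. Then the algorithm has speedup factor $3-\frac{1}{M}$: whenever it returns failure on ${\bf T}$, the task set ${\bf T}$ cannot be feasibly scheduled by any preemptive multiprocessor scheduling algorithm on $M$ identical processors each of speed $\frac{1}{3-1/M}$.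
   Context: A sporadic task $\tau_i=(C_i,T_i,D_i)$ has worst-case execution time $C_i>0$, minimum inter-arrival time $T_i>0$ (the value $T_i=\infty$ is allowed and means at most one job), and relative deadline $D_i>0$; it releases jobs whose consecutive release times are at least $T_i$ apart, and a job released at time $r$ must receive its execution by $r+D_i$. On a processor of speed $s$ a job of $\tau_i$ needs $C_i/s$ time units. $U_i=C_i/T_i$ (with $U_i=0$ if $T_i=\infty$). "Arbitrary deadlines" means no relation between $D_i$ and $T_i$ is assumed. Deadline-monotonic partitioning algorithm: given the tasks indexed by non-decreasing relative deadline and a per-processor test, set ${\bf T}_1=\{\tau_1\}$ and ${\bf T}_m=\emptyset$ for $m=2,\dots,M$. For $k=2,\dots,N$: if some processor $m$ has ${\bf T}_m\cup\{\tau_k\}$ passing the test, choose one such $m$ according to the fitting strategy (any rule, e.g., first-fit, best-fit, worst-fit, or an arbitrary choice) and set ${\bf T}_m\leftarrow{\bf T}_m\cup\{\tau_k\}$; otherwise return failure ("no feasible schedule is found"). If all tasks are assigned, return the partition; each processor then runs preemptive deadline-monotonic fixed-priority scheduling (shorter relative deadline = higher priority). A feasible schedule means every job of every legal sporadic arrival sequence meets its deadline. *)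

theory Defs
  imports "HOL-Analysis.Analysis"
begin

section \<open>Sporadic tasks\<close>

record task =
  wcet :: real
  period :: ereal   \<comment> \<open>minimum inter-arrival time; \<open>\<infinity>\<close> means at most one job\<close>
  deadline :: real

definition sporadic_task :: "task \<Rightarrow> bool" where
  "sporadic_task \<tau> \<longleftrightarrow> wcet \<tau> > 0 \<and> period \<tau> > 0 \<and> deadline \<tau> > 0"

text \<open>The quotient of \<open>x\<close> by the period, with \<open>x / \<infinity> = 0\<close>.\<close>

definition over_period :: "real \<Rightarrow> task \<Rightarrow> real" where
  "over_period x \<tau> = (if period \<tau> = \<infinity> then 0 else x / real_of_ereal (period \<tau>))"

definition utilization :: "task \<Rightarrow> real" where
  "utilization \<tau> = over_period (wcet \<tau>) \<tau>"

section \<open>Arrival sequences and schedules\<close>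

text \<open>
  A task system consists of the tasks \<open>\<tau> i\<close> for \<open>i \<in> {1..N}\<close>.  An arrival sequence gives, for each
  task index, the set of its release times.  Since periods are positive, two jobs of one task have
  different release times, so the pair \<open>(i, r)\<close> identifies the job of task \<open>i\<close> released at \<open>r\<close>.
  For an infinite period the separation condition admits at most one release.
\<close>

type_synonym arrivals = "nat \<Rightarrow> real set"

definition legal_arrivals :: "nat \<Rightarrow> (nat \<Rightarrow> task) \<Rightarrow> arrivals \<Rightarrow> bool" where
  "legal_arrivals N \<tau> R \<longleftrightarrow>
     (\<forall>i\<in>{1..N}. R i \<subseteq> {0..} \<and>
        (\<forall>r\<in>R i. \<forall>r'\<in>R i. r < r' \<longrightarrow> period (\<tau> i) \<le> ereal (r' - r)))"

text \<open>
  \<open>\<sigma> m t\<close> is the job executed by processor \<open>m\<close> at time \<open>t\<close>, if any.  Preemption and migration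
  are unrestricted.  A task occupies at most one processor at any time: neither a single job nor
  two jobs of the same task run in parallel.  Jobs of the same task may be executed in any order.
  Measurability makes the execution time of a job well defined.
\<close>

type_synonym schedule = "nat \<Rightarrow> real \<Rightarrow> (nat \<times> real) option"

definition valid_schedule :: "nat \<Rightarrow> nat \<Rightarrow> arrivals \<Rightarrow> schedule \<Rightarrow> bool" where
  "valid_schedule M N R \<sigma> \<longleftrightarrow>
     (\<forall>m\<in>{1..M}. \<forall>t i r. \<sigma> m t = Some (i, r) \<longrightarrow> i \<in> {1..N} \<and> r \<in> R i \<and> r \<le> t) \<and>
     (\<forall>m\<in>{1..M}. \<forall>m'\<in>{1..M}. \<forall>t i r r'.
        \<sigma> m t = Some (i, r) \<and> \<sigma> m' t = Some (i, r') \<longrightarrow> m = m') \<and>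
     (\<forall>m\<in>{1..M}. \<forall>i\<in>{1..N}. \<forall>r\<in>R i. {t. \<sigma> m t = Some (i, r)} \<in> sets lebesgue)"

definition exec_time :: "nat \<Rightarrow> schedule \<Rightarrow> nat \<times> real \<Rightarrow> real set \<Rightarrow> real" where
  "exec_time M \<sigma> j I = (\<Sum>m=1..M. measure lebesgue {t\<in>I. \<sigma> m t = Some j})"

definition meets_deadlines ::
    "nat \<Rightarrow> real \<Rightarrow> nat \<Rightarrow> (nat \<Rightarrow> task) \<Rightarrow> arrivals \<Rightarrow> schedule \<Rightarrow> bool" where
  "meets_deadlines M s N \<tau> R \<sigma> \<longleftrightarrow>
     (\<forall>i\<in>{1..N}. \<forall>r\<in>R i.
        exec_time M \<sigma> (i, r) {r..r + deadline (\<tau> i)} \<ge> wcet (\<tau> i) / s)"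

text \<open>
  A scheduling algorithm maps each arrival sequence to a schedule.  It may be clairvoyant, so online
  algorithms, fixed-priority or dynamic-priority, global or partitioned, are all included.
\<close>

definition schedulable_by ::
    "(arrivals \<Rightarrow> schedule) \<Rightarrow> nat \<Rightarrow> real \<Rightarrow> nat \<Rightarrow> (nat \<Rightarrow> task) \<Rightarrow> bool" where
  "schedulable_by alg M s N \<tau> \<longleftrightarrow>
     (\<forall>R. legal_arrivals N \<tau> R \<longrightarrow>
        valid_schedule M N R (alg R) \<and> meets_deadlines M s N \<tau> R (alg R))"

section \<open>Deadline-monotonic partitioning\<close>

text \<open>\<open>P m\<close> is the set of indices of the tasks assigned to processor \<open>m\<close>.\<close>

type_synonym partition = "nat \<Rightarrow> nat set"

text \<open>
  A fitting strategy selects, for the task index to be placed and the current partition, one of the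
  processors in a nonempty set of candidates.
\<close>

type_synonym fitting = "nat \<Rightarrow> partition \<Rightarrow> nat set \<Rightarrow> nat"

definition fitting_strategy :: "nat \<Rightarrow> fitting \<Rightarrow> bool" where
  "fitting_strategy M fit \<longleftrightarrow> (\<forall>k P A. A \<subseteq> {1..M} \<and> A \<noteq> {} \<longrightarrow> fit k P A \<in> A)"

text \<open>
  \<open>test S k\<close> tells whether the task with index \<open>k\<close> may join the tasks with indices in \<open>S\<close>.  The last
  argument is the number of tasks.  The first task is placed on processor 1 without being tested.
  \<open>None\<close> is failure.
\<close>

fun dm_partition :: "(nat set \<Rightarrow> nat \<Rightarrow> bool) \<Rightarrow> fitting \<Rightarrow> nat \<Rightarrow> nat \<Rightarrow> partition option" where
  "dm_partition test fit M 0 = Some (\<lambda>m. {})"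
| "dm_partition test fit M (Suc 0) = Some ((\<lambda>m. {})(1 := {1}))"
| "dm_partition test fit M (Suc (Suc n)) =
     (case dm_partition test fit M (Suc n) of
        None \<Rightarrow> None
      | Some P \<Rightarrow>
          (let k = Suc (Suc n); A = {m\<in>{1..M}. test (P m) k} in
           if A = {} then None
           else (let m = fit k P A in Some (P(m := insert k (P m))))))"

definition arbitrary_deadline_test :: "(nat \<Rightarrow> task) \<Rightarrow> nat set \<Rightarrow> nat \<Rightarrow> bool" where
  "arbitrary_deadline_test \<tau> S k \<longleftrightarrow>
     wcet (\<tau> k) + (\<Sum>i\<in>S. (1 + over_period (deadline (\<tau> k)) (\<tau> i)) * wcet (\<tau> i)) \<le> deadline (\<tau> k) \<and>
     utilization (\<tau> k) + (\<Sum>i\<in>S. utilization (\<tau> i)) \<le> 1"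

end

theory Submission
  imports Defs
begin

text \<open>
  Let \<open>\<tau> k\<close> be the task that cannot be placed, and suppose that a schedule at speed \<open>s\<close> exists for
  the synchronous periodic arrival sequence.  Counting the work due by \<open>D\<^sub>k\<close> bounds
  \<open>\<Sum>\<^sub>i\<^sub>\<le>\<^sub>k C\<^sub>i / D\<^sub>k\<close> by \<open>M s\<close> and \<open>C\<^sub>k / D\<^sub>k\<close> by \<open>s\<close>; counting the work due by a time
  \<open>L \<rightarrow> \<infinity>\<close> bounds \<open>\<Sum>\<^sub>i\<^sub>\<le>\<^sub>k U\<^sub>i\<close> by \<open>M s\<close> and \<open>U\<^sub>k\<close> by \<open>s\<close>.
  Put \<open>b = max (C\<^sub>k / D\<^sub>k) U\<^sub>k \<le> s\<close>.  Whichever half of the test fails on a processor \<open>m\<close>, the sum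
  of \<open>C\<^sub>i / D\<^sub>k + U\<^sub>i\<close> over the tasks on \<open>m\<close> exceeds \<open>1 - b\<close>.  Summing over the processors gives
  \<open>M (1 - b) < 2 M s - b\<close>, hence \<open>(3 M - 1) s > M\<close>.
\<close>

section \<open>Upper bounds on the work a valid schedule completes in a window\<close>

lemma sum_measure_disjoint_le:
  fixes L :: real
  assumes "finite A" and "\<And>x. x \<in> A \<Longrightarrow> Q x \<in> sets lebesgue" and "\<And>x. x \<in> A \<Longrightarrow> Q x \<subseteq> {0..L}"
    and "disjoint_family_on Q A" and "0 \<le> L"
  shows "(\<Sum>x\<in>A. measure lebesgue (Q x)) \<le> L"
proof -
  have lm: "Q x \<in> lmeasurable" if "x \<in> A" for x
    using assms(2,3)[OF that]
    by (intro bounded_set_imp_lmeasurable bounded_subset[OF bounded_closed_interval])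
  have "(\<Sum>x\<in>A. measure lebesgue (Q x)) = measure lebesgue (\<Union>x\<in>A. Q x)"
    using assms lm
    by (intro measure_UNION'[symmetric]) (auto simp: disjoint_family_on_def pairwise_def disjnt_def)
  also have "\<dots> \<le> measure lebesgue {0..L}"
    using assms lm by (intro measure_mono_fmeasurable) auto
  finally show ?thesis
    using \<open>0 \<le> L\<close> by simp
qed

lemma legal_arrivals_nonneg:
  "legal_arrivals N \<tau> R \<Longrightarrow> i \<in> {1..N} \<Longrightarrow> r \<in> R i \<Longrightarrow> 0 \<le> r"
  unfolding legal_arrivals_def by (meson atLeast_iff subsetD)

lemma valid_schedule_same_task:
  "valid_schedule M N R \<sigma> \<Longrightarrow> m \<in> {1..M} \<Longrightarrow> m' \<in> {1..M} \<Longrightarrow> \<sigma> m t = Some (i, r) \<Longrightarrow>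
    \<sigma> m' t = Some (i, r') \<Longrightarrow> m = m'"
  unfolding valid_schedule_def by metis

lemma valid_schedule_measurable:
  fixes L :: real
  assumes "valid_schedule M N R \<sigma>" "m \<in> {1..M}" "i \<in> {1..N}" "r \<in> R i"
  shows "{t\<in>{0..L}. \<sigma> m t = Some (i, r)} \<in> sets lebesgue"
proof -
  have "{t. \<sigma> m t = Some (i, r)} \<in> sets lebesgue"
    using assms unfolding valid_schedule_def by blast
  then have "{0..L} \<inter> {t. \<sigma> m t = Some (i, r)} \<in> sets lebesgue"
    by (intro sets.Int) simp_all
  then show ?thesis by (simp add: Int_def)
qed

text \<open>Releases are nonnegative, so the job's own window lies inside \<open>{0..L}\<close>.
  Passing to this common window lets the execution times of different jobs be added.\<close>

lemma wcet_le_exec_time: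
  assumes "legal_arrivals N \<tau> R" and v: "valid_schedule M N R \<sigma>" and "meets_deadlines M s N \<tau> R \<sigma>"
    and "i \<in> {1..N}" "r \<in> R i" "r + deadline (\<tau> i) \<le> L"
  shows "wcet (\<tau> i) / s \<le> exec_time M \<sigma> (i, r) {0..L}"
proof -
  have r: "0 \<le> r" using legal_arrivals_nonneg assms by blast
  have "measure lebesgue {t\<in>{r..r + deadline (\<tau> i)}. \<sigma> m t = Some (i, r)}
      \<le> measure lebesgue {t\<in>{0..L}. \<sigma> m t = Some (i, r)}" if "m \<in> {1..M}" for m
  proof (rule measure_mono_fmeasurable)
    show "{t\<in>{0..L}. \<sigma> m t = Some (i, r)} \<in> lmeasurable"
      using valid_schedule_measurable[OF v that assms(4,5)]
      by (intro bounded_set_imp_lmeasurable bounded_subset[OF bounded_closed_interval[of 0 L]]) blast+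
    have "{r..r + deadline (\<tau> i)} \<inter> {t\<in>{0..L}. \<sigma> m t = Some (i, r)} \<in> sets lebesgue"
      using valid_schedule_measurable[OF v that assms(4,5)] by (intro sets.Int) simp_all
    moreover have "{r..r + deadline (\<tau> i)} \<inter> {t\<in>{0..L}. \<sigma> m t = Some (i, r)}
        = {t\<in>{r..r + deadline (\<tau> i)}. \<sigma> m t = Some (i, r)}"
      using r assms(6) by auto
    ultimately show "{t\<in>{r..r + deadline (\<tau> i)}. \<sigma> m t = Some (i, r)} \<in> sets lebesgue"
      by (simp only:)
  qed (use r assms(6) in auto)
  then have "exec_time M \<sigma> (i, r) {r..r + deadline (\<tau> i)} \<le> exec_time M \<sigma> (i, r) {0..L}"
    unfolding exec_time_def by (intro sum_mono)
  moreover have "wcet (\<tau> i) / s \<le> exec_time M \<sigma> (i, r) {r..r + deadline (\<tau> i)}"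
    using assms(3-5) unfolding meets_deadlines_def by blast
  ultimately show ?thesis by linarith
qed

text \<open>A processor runs one job at a time, so the execution sets of distinct jobs on it are
  disjoint subsets of \<open>{0..L}\<close>; each of the \<open>M\<close> processors contributes at
  most \<open>L\<close>.\<close>

lemma work_le:
  assumes "legal_arrivals N \<tau> R" and v: "valid_schedule M N R \<sigma>" and "meets_deadlines M s N \<tau> R \<sigma>"
    and "finite J" and J: "\<And>i r. (i, r) \<in> J \<Longrightarrow> i \<in> {1..N} \<and> r \<in> R i \<and> r + deadline (\<tau> i) \<le> L"
    and "0 \<le> L"
  shows "(\<Sum>(i, r)\<in>J. wcet (\<tau> i) / s) \<le> real M * L"
proof -
  have exec: "(case j of (i, r) \<Rightarrow> wcet (\<tau> i) / s) \<le> exec_time M \<sigma> j {0..L}" if "j \<in> J" for j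
  proof (cases j)
    case (Pair i r)
    with J[of i r] that show ?thesis
      using wcet_le_exec_time[OF assms(1-3), of i r L] by simp
  qed
  have meas: "{t\<in>{0..L}. \<sigma> m t = Some j} \<in> sets lebesgue" if "m \<in> {1..M}" "j \<in> J" for m j
  proof (cases j)
    case (Pair i r)
    with J[of i r] that show ?thesis
      using valid_schedule_measurable[OF v, of m i r L] by simp
  qed
  have "(\<Sum>(i, r)\<in>J. wcet (\<tau> i) / s) \<le> (\<Sum>j\<in>J. exec_time M \<sigma> j {0..L})"
    by (rule sum_mono) (rule exec)
  also have "\<dots> = (\<Sum>m=1..M. \<Sum>j\<in>J. measure lebesgue {t\<in>{0..L}. \<sigma> m t = Some j})"
    unfolding exec_time_def by (rule sum.swap)
  also have "\<dots> \<le> (\<Sum>m=1..M. L)"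
  proof (intro sum_mono sum_measure_disjoint_le)
    show "disjoint_family_on (\<lambda>j. {t\<in>{0..L}. \<sigma> m t = Some j}) J" for m
      by (auto simp: disjoint_family_on_def)
  qed (use meas assms(4,6) in blast)+
  finally show ?thesis by simp
qed

text \<open>The factor \<open>M\<close> disappears because a task never runs in parallel with
  itself, not even through different jobs.\<close>

lemma work_single_task_le:
  assumes "legal_arrivals N \<tau> R" and v: "valid_schedule M N R \<sigma>" and "meets_deadlines M s N \<tau> R \<sigma>"
    and i: "i \<in> {1..N}" and "finite J" and J: "\<And>r. r \<in> J \<Longrightarrow> r \<in> R i \<and> r + deadline (\<tau> i) \<le> L"
    and "0 \<le> L"
  shows "real (card J) * wcet (\<tau> i) / s \<le> L"
proof -
  have "real (card J) * wcet (\<tau> i) / s = (\<Sum>r\<in>J. wcet (\<tau> i) / s)" by simp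
  also have "\<dots> \<le> (\<Sum>r\<in>J. exec_time M \<sigma> (i, r) {0..L})"
    by (intro sum_mono wcet_le_exec_time[OF assms(1-3) i]) (simp_all add: J)
  \<comment> \<open>Jobs and processors are merged into one index set: the execution sets are
    disjoint across processors too, so a single window of length \<open>L\<close> holds them
    all.\<close>
  also have "\<dots> = (\<Sum>(r, m)\<in>J \<times> {1..M}. measure lebesgue {t\<in>{0..L}. \<sigma> m t = Some (i, r)})"
    unfolding exec_time_def by (simp add: sum.cartesian_product)
  also have "\<dots> = (\<Sum>x\<in>J \<times> {1..M}. measure lebesgue {t\<in>{0..L}. \<sigma> (snd x) t = Some (i, fst x)})"
    by (simp add: case_prod_unfold)
  also have "\<dots> \<le> L"
  proof (rule sum_measure_disjoint_le)
    show "disjoint_family_on (\<lambda>x. {t\<in>{0..L}. \<sigma> (snd x) t = Some (i, fst x)}) (J \<times> {1..M})"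
    proof (unfold disjoint_family_on_def, intro ballI impI equals0I)
      fix x y t assume "x \<in> J \<times> {1..M}" "y \<in> J \<times> {1..M}" "x \<noteq> y"
        and "t \<in> {t\<in>{0..L}. \<sigma> (snd x) t = Some (i, fst x)} \<inter> {t\<in>{0..L}. \<sigma> (snd y) t = Some (i, fst y)}"
      \<comment> \<open>Exclusivity of the task makes the processors agree; one processor runs one
        job at an instant, so the releases agree as well.\<close>
      moreover from this have "snd x = snd y"
        using valid_schedule_same_task[OF v, of "snd x" "snd y" t i "fst x" "fst y"] by auto
      ultimately show False by (auto simp: prod_eq_iff)
    qed
    show "{t\<in>{0..L}. \<sigma> (snd x) t = Some (i, fst x)} \<in> sets lebesgue" if "x \<in> J \<times> {1..M}" for x
      using that J by (intro valid_schedule_measurable[OF v _ i]) auto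
  qed (use assms(5,7) in auto)
  finally show ?thesis .
qed

section \<open>The synchronous periodic arrival sequence and its demand\<close>

definition synchronous_arrivals :: "(nat \<Rightarrow> task) \<Rightarrow> arrivals" where
  "synchronous_arrivals \<tau> i =
     (if period (\<tau> i) = \<infinity> then {0} else range (\<lambda>n. real n * real_of_ereal (period (\<tau> i))))"

lemma sporadic_task_finite_period:
  assumes "sporadic_task t" "period t \<noteq> \<infinity>"
  obtains T where "period t = ereal T" "0 < T"
  using assms unfolding sporadic_task_def by (cases "period t") auto

lemma utilization_nonneg:
  assumes "sporadic_task t"
  shows "0 \<le> utilization t"
proof (cases "period t = \<infinity>")
  case False
  with assms obtain T where "period t = ereal T" "0 < T"
    by (rule sporadic_task_finite_period)
  with assms show ?thesis by (simp add: utilization_def over_period_def sporadic_task_def)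
qed (simp add: utilization_def over_period_def)

lemma zero_in_synchronous_arrivals: "0 \<in> synchronous_arrivals \<tau> i"
  unfolding synchronous_arrivals_def by (auto intro: range_eqI[of _ _ 0])

lemma legal_synchronous_arrivals:
  assumes "\<forall>i\<in>{1..N}. sporadic_task (\<tau> i)"
  shows "legal_arrivals N \<tau> (synchronous_arrivals \<tau>)"
  unfolding legal_arrivals_def
proof (intro ballI)
  fix i assume "i \<in> {1..N}"
  then have sp: "sporadic_task (\<tau> i)" using assms by blast
  show "synchronous_arrivals \<tau> i \<subseteq> {0..} \<and> (\<forall>r\<in>synchronous_arrivals \<tau> i.
      \<forall>r'\<in>synchronous_arrivals \<tau> i. r < r' \<longrightarrow> period (\<tau> i) \<le> ereal (r' - r))"
  proof (cases "period (\<tau> i) = \<infinity>")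
    case False
    with sp obtain T where T: "period (\<tau> i) = ereal T" "0 < T"
      by (rule sporadic_task_finite_period)
    have "T \<le> real n' * T - real n * T" if "real n * T < real n' * T" for n n'
    proof -
      have "1 \<le> real n' - real n" using that T by simp
      then have "1 * T \<le> (real n' - real n) * T" using T by (intro mult_right_mono) auto
      then show ?thesis by (simp add: algebra_simps)
    qed
    with T show ?thesis by (auto simp: synchronous_arrivals_def)
  qed (auto simp: synchronous_arrivals_def)
qed

text \<open>A linear lower bound on the demand due by \<open>L\<close>, with slope the utilization.
  The jobs counted are those released in \<open>[0, L - D]\<close>, where \<open>D\<close> is the
  task's deadline; an infinite period gives slope 0.\<close>

lemma synchronous_arrivals_demand:
  assumes "sporadic_task (\<tau> i)" "deadline (\<tau> i) \<le> L"
  obtains J where "finite J" "J \<subseteq> {r \<in> synchronous_arrivals \<tau> i. r + deadline (\<tau> i) \<le> L}"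
    "(L - deadline (\<tau> i)) * utilization (\<tau> i) \<le> real (card J) * wcet (\<tau> i)"
proof (cases "period (\<tau> i) = \<infinity>")
  case True
  then show ?thesis
    using assms that[of "{0}"]
    by (auto simp: synchronous_arrivals_def utilization_def over_period_def sporadic_task_def)
next
  case False
  with assms(1) obtain T where T: "period (\<tau> i) = ereal T" "0 < T"
    by (rule sporadic_task_finite_period)
  let ?x = "(L - deadline (\<tau> i)) / T"
  let ?J = "(\<lambda>n. real n * T) ` {..nat \<lfloor>?x\<rfloor>}"
  have x: "0 \<le> ?x" using assms T by simp
  have le: "real n * T + deadline (\<tau> i) \<le> L" if "n \<le> nat \<lfloor>?x\<rfloor>" for n
  proof -
    have "real n \<le> ?x" using that x by linarith
    then show ?thesis using T by (simp add: field_simps)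
  qed
  \<comment> \<open>The release at 0 counts as well; this extra job compensates for rounding
    \<open>?x\<close> down.\<close>
  have "card ?J = Suc (nat \<lfloor>?x\<rfloor>)"
    using T by (subst card_image) (auto simp: inj_on_def)
  then have "?x \<le> real (card ?J)" by linarith
  then have "?x * wcet (\<tau> i) \<le> real (card ?J) * wcet (\<tau> i)"
    using assms by (intro mult_right_mono) (auto simp: sporadic_task_def)
  moreover have "(L - deadline (\<tau> i)) * utilization (\<tau> i) = ?x * wcet (\<tau> i)"
    using T by (simp add: utilization_def over_period_def)
  ultimately show ?thesis
    using le T False by (intro that[of ?J]) (auto simp: synchronous_arrivals_def)
qed

text \<open>The limit \<open>L \<rightarrow> \<infinity>\<close> in elementary form: the offset
  \<open>D\<close> is a bounded loss and cannot affect the comparison of slopes.\<close>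

lemma le_of_linear_growth:
  fixes A B D :: real
  assumes "0 \<le> D" and "\<And>L. D \<le> L \<Longrightarrow> (L - D) * A \<le> B * L"
  shows "A \<le> B"
proof (rule ccontr)
  assume "\<not> A \<le> B"
  \<comment> \<open>The hypothesis rearranges to \<open>(L - D) * (A - B) \<le> D * B\<close>; this
    \<open>L\<close> makes the left side \<open>\<bar>D * B\<bar> + 1\<close>.\<close>
  define L where "L = D + (\<bar>D * B\<bar> + 1) / (A - B)"
  have "D \<le> L" using \<open>\<not> A \<le> B\<close> by (simp add: L_def)
  moreover have "(L - D) * (A - B) = \<bar>D * B\<bar> + 1" using \<open>\<not> A \<le> B\<close> by (simp add: L_def)
  ultimately show False using assms(2)[of L] by (simp add: algebra_simps)
qed

section \<open>Necessary conditions for meeting the synchronous deadlines at speed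
  \<open>s\<close>\<close>

context
  fixes M N k :: nat and s :: real and \<tau> :: "nat \<Rightarrow> task" and \<sigma> :: schedule
  assumes s: "0 < s" and tasks: "\<forall>i\<in>{1..N}. sporadic_task (\<tau> i)"
    and mono: "\<forall>i\<in>{1..N}. \<forall>j\<in>{1..N}. i \<le> j \<longrightarrow> deadline (\<tau> i) \<le> deadline (\<tau> j)"
    and k: "k \<in> {1..N}"
    and valid: "valid_schedule M N (synchronous_arrivals \<tau>) \<sigma>"
    and meets: "meets_deadlines M s N \<tau> (synchronous_arrivals \<tau>) \<sigma>"
begin

lemma deadline_pos: "0 < deadline (\<tau> k)"
  using tasks k unfolding sporadic_task_def by blast

text \<open>By the deadline ordering, the jobs that tasks \<open>1..k\<close> release at 0 are all
  due by the deadline of task \<open>k\<close>.\<close>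

lemma sum_wcet_le: "(\<Sum>i=1..k. wcet (\<tau> i)) \<le> real M * s * deadline (\<tau> k)"
proof -
  have "(\<Sum>(i, r)\<in>{1..k} \<times> {0::real}. wcet (\<tau> i) / s) \<le> real M * deadline (\<tau> k)"
    using mono k deadline_pos
    by (intro work_le[OF legal_synchronous_arrivals[OF tasks] valid meets])
      (auto simp: zero_in_synchronous_arrivals)
  then have "(\<Sum>i=1..k. wcet (\<tau> i)) / s \<le> real M * deadline (\<tau> k)"
    by (simp flip: sum.cartesian_product add: sum_divide_distrib)
  then show ?thesis using s by (simp add: field_simps)
qed

text \<open>The job released at 0 must finish within its deadline while using one processor at a
  time.\<close>

lemma density_le: "wcet (\<tau> k) / deadline (\<tau> k) \<le> s"
proof -
  have "real (card {0::real}) * wcet (\<tau> k) / s \<le> deadline (\<tau> k)"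
    using k deadline_pos
    by (intro work_single_task_le[OF legal_synchronous_arrivals[OF tasks] valid meets])
      (auto simp: zero_in_synchronous_arrivals)
  then show ?thesis using s deadline_pos by (simp add: field_simps)
qed

text \<open>Long-run counterpart of \<open>density_le\<close>: all jobs of task \<open>k\<close> due
  by \<open>L\<close> share the capacity \<open>s * L\<close> of one processor.\<close>

lemma utilization_le: "utilization (\<tau> k) \<le> s"
proof (rule le_of_linear_growth)
  fix L assume L: "deadline (\<tau> k) \<le> L"
  obtain J where J: "finite J" "J \<subseteq> {r \<in> synchronous_arrivals \<tau> k. r + deadline (\<tau> k) \<le> L}"
      "(L - deadline (\<tau> k)) * utilization (\<tau> k) \<le> real (card J) * wcet (\<tau> k)"
    using synchronous_arrivals_demand[of \<tau> k L] L tasks k by metis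
  have "real (card J) * wcet (\<tau> k) / s \<le> L"
  proof (rule work_single_task_le[OF legal_synchronous_arrivals[OF tasks] valid meets k J(1)])
    show "r \<in> synchronous_arrivals \<tau> k \<and> r + deadline (\<tau> k) \<le> L" if "r \<in> J" for r
      using that J(2) by blast
    show "0 \<le> L" using deadline_pos L by linarith
  qed
  then have "real (card J) * wcet (\<tau> k) \<le> s * L"
    using s by (simp add: field_simps)
  with J(3) show "(L - deadline (\<tau> k)) * utilization (\<tau> k) \<le> s * L"
    by linarith
qed (use deadline_pos in simp)

lemma sum_utilization_le: "(\<Sum>i=1..k. utilization (\<tau> i)) \<le> real M * s"
proof (rule le_of_linear_growth)
  fix L assume L: "deadline (\<tau> k) \<le> L"
  have dl: "deadline (\<tau> i) \<le> deadline (\<tau> k)" if "i \<in> {1..k}" for i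
    using mono k that by auto
  have "\<forall>i\<in>{1..k}. \<exists>J. finite J \<and>
      J \<subseteq> {r \<in> synchronous_arrivals \<tau> i. r + deadline (\<tau> i) \<le> L} \<and>
      (L - deadline (\<tau> i)) * utilization (\<tau> i) \<le> real (card J) * wcet (\<tau> i)"
  proof
    fix i assume i: "i \<in> {1..k}"
    have "sporadic_task (\<tau> i)" using tasks k i by simp
    moreover have "deadline (\<tau> i) \<le> L" using dl[OF i] L by linarith
    ultimately show "\<exists>J. finite J \<and>
        J \<subseteq> {r \<in> synchronous_arrivals \<tau> i. r + deadline (\<tau> i) \<le> L} \<and>
        (L - deadline (\<tau> i)) * utilization (\<tau> i) \<le> real (card J) * wcet (\<tau> i)"
      using synchronous_arrivals_demand[of \<tau> i L] by metis
  qed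
  from bchoice[OF this] obtain J where J: "\<And>i. i \<in> {1..k} \<Longrightarrow> finite (J i)"
      "\<And>i. i \<in> {1..k} \<Longrightarrow> J i \<subseteq> {r \<in> synchronous_arrivals \<tau> i. r + deadline (\<tau> i) \<le> L}"
      "\<And>i. i \<in> {1..k} \<Longrightarrow>
        (L - deadline (\<tau> i)) * utilization (\<tau> i) \<le> real (card (J i)) * wcet (\<tau> i)"
    by blast
  have "(L - deadline (\<tau> k)) * (\<Sum>i=1..k. utilization (\<tau> i))
      \<le> (\<Sum>i=1..k. real (card (J i)) * wcet (\<tau> i))"
    unfolding sum_distrib_left
  proof (rule sum_mono)
    fix i assume i: "i \<in> {1..k}"
    \<comment> \<open>The largest deadline serves as a common offset, so that
      \<open>le_of_linear_growth\<close> applies to the whole sum.\<close>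
    have "(L - deadline (\<tau> k)) * utilization (\<tau> i) \<le> (L - deadline (\<tau> i)) * utilization (\<tau> i)"
      using dl[OF i] tasks i k by (intro mult_right_mono utilization_nonneg) auto
    with J(3)[OF i] show "(L - deadline (\<tau> k)) * utilization (\<tau> i) \<le> real (card (J i)) * wcet (\<tau> i)"
      by linarith
  qed
  moreover have "(\<Sum>(i, r)\<in>Sigma {1..k} J. wcet (\<tau> i) / s) \<le> real M * L"
  proof (intro work_le[OF legal_synchronous_arrivals[OF tasks] valid meets])
    show "finite (Sigma {1..k} J)" using J(1) by blast
    show "i \<in> {1..N} \<and> r \<in> synchronous_arrivals \<tau> i \<and> r + deadline (\<tau> i) \<le> L"
      if "(i, r) \<in> Sigma {1..k} J" for i r
    proof -
      have i: "i \<in> {1..k}" and "r \<in> J i" using that by auto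
      then show ?thesis using J(2)[OF i] k by auto
    qed
    show "0 \<le> L" using deadline_pos L by linarith
  qed
  then have "(\<Sum>i=1..k. real (card (J i)) * wcet (\<tau> i)) / s \<le> real M * L"
    using J(1) by (simp add: sum.Sigma[symmetric] sum_divide_distrib)
  then have "(\<Sum>i=1..k. real (card (J i)) * wcet (\<tau> i)) \<le> real M * s * L"
    using s by (simp add: field_simps)
  ultimately show "(L - deadline (\<tau> k)) * (\<Sum>i=1..k. utilization (\<tau> i)) \<le> real M * s * L"
    by linarith
qed (use deadline_pos in simp)

end

section \<open>The partition held when the algorithm fails\<close>

lemma dm_partition_disjoint:
  assumes "dm_partition test fit M n = Some P"
  shows "(\<forall>m. P m \<subseteq> {1..n}) \<and> disjoint_family P"
  using assms
proof (induction test fit M n arbitrary: P rule: dm_partition.induct)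
  case (3 test fit M n)
  then obtain P' m where some: "dm_partition test fit M (Suc n) = Some P'"
      and P: "P = P'(m := insert (Suc (Suc n)) (P' m))"
    by (auto simp: Let_def split: option.splits if_splits)
  from "3.IH"[OF some] have sub: "P' m' \<subseteq> {1..Suc n}" for m' by blast
  from "3.IH"[OF some] have dis: "P' a \<inter> P' b = {}" if "a \<noteq> b" for a b
    using that by (simp add: disjoint_family_on_def)
  \<comment> \<open>The new index exceeds all placed ones, so inserting it preserves
    disjointness.\<close>
  have new: "Suc (Suc n) \<notin> P' m'" for m'
    using sub[of m'] by auto
  have "P m' \<subseteq> {1..Suc (Suc n)}" for m'
    using sub[of m'] by (auto simp: P)
  moreover have "P a \<inter> P b = {}" if "a \<noteq> b" for a b
    using new dis[OF that] that by (auto simp: P)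
  ultimately show ?case by (simp add: disjoint_family_on_def)
qed (auto simp: disjoint_family_on_def)

text \<open>Failure persists once it occurs; tracing it back reaches the index \<open>Suc n\<close>
  that every processor rejects, with \<open>P\<close> the partition of the earlier tasks.\<close>

lemma dm_partition_failure:
  assumes "dm_partition test fit M N = None"
  obtains n P where "Suc n \<le> N" "dm_partition test fit M n = Some P"
    "\<And>m. m \<in> {1..M} \<Longrightarrow> \<not> test (P m) (Suc n)"
  using assms
proof (induction test fit M N arbitrary: thesis rule: dm_partition.induct)
  case (3 test fit M n)
  show ?case
  proof (cases "dm_partition test fit M (Suc n)")
    case None
    from "3.IH"[OF _ None] "3.prems"(1) show ?thesis by (metis le_SucI)
  next
    case (Some P)
    with "3.prems" show ?thesis by (auto simp: Let_def split: if_splits)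
  qed
qed auto

text \<open>Dividing the first half of the test by the deadline of \<open>\<tau> k\<close> turns its
  summands into exactly those shown. In the second half, adding the nonnegative densities only
  strengthens the violation. The \<open>max\<close> covers both cases.\<close>

lemma test_failure_bound:
  assumes "0 < deadline (\<tau> k)" "\<And>i. i \<in> S \<Longrightarrow> 0 \<le> wcet (\<tau> i)"
    and "\<not> arbitrary_deadline_test \<tau> S k"
  shows "(\<Sum>i\<in>S. wcet (\<tau> i) / deadline (\<tau> k) + utilization (\<tau> i))
    > 1 - max (wcet (\<tau> k) / deadline (\<tau> k)) (utilization (\<tau> k))"
proof -
  let ?D = "deadline (\<tau> k)"
  have "(\<Sum>i\<in>S. (1 + over_period ?D (\<tau> i)) * wcet (\<tau> i))
      = ?D * (\<Sum>i\<in>S. wcet (\<tau> i) / ?D + utilization (\<tau> i))"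
    using assms(1) unfolding sum_distrib_left
    by (intro sum.cong) (auto simp: utilization_def over_period_def field_simps)
  moreover have "(\<Sum>i\<in>S. utilization (\<tau> i)) \<le> (\<Sum>i\<in>S. wcet (\<tau> i) / ?D + utilization (\<tau> i))"
    using assms(1,2) by (intro sum_mono) auto
  moreover have "?D < wcet (\<tau> k) + ?D * x \<Longrightarrow> 1 < wcet (\<tau> k) / ?D + x" for x
    using assms(1) by (simp add: field_simps)
  ultimately show ?thesis
    using assms(3) unfolding arbitrary_deadline_test_def by (smt (verit))
qed

section \<open>The speedup factor\<close>

theorem theorem2:
  fixes M N :: nat and \<tau> :: "nat \<Rightarrow> task" and fit :: fitting
  assumes "M \<ge> 1" and "N \<ge> 1"
    and "\<forall>i\<in>{1..N}. sporadic_task (\<tau> i)"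
    and "\<forall>i\<in>{1..N}. \<forall>j\<in>{1..N}. i \<le> j \<longrightarrow> deadline (\<tau> i) \<le> deadline (\<tau> j)"
    and "fitting_strategy M fit"
    and "dm_partition (arbitrary_deadline_test \<tau>) fit M N = None"
  shows "\<not> (\<exists>alg. schedulable_by alg M (1 / (3 - 1 / real M)) N \<tau>)"
proof
  assume "\<exists>alg. schedulable_by alg M (1 / (3 - 1 / real M)) N \<tau>"
  then obtain alg where alg: "schedulable_by alg M (1 / (3 - 1 / real M)) N \<tau>" ..
  define s where "s = 1 / (3 - 1 / real M)"
  have M: "1 \<le> real M" using assms(1) by simp
  then have "1 / real M \<le> 1" by simp
  then have s: "0 < s" by (simp add: s_def)
  \<comment> \<open>Division-free form of the speed, to be contradicted at the end.\<close>
  have sM: "(3 * real M - 1) * s = real M"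
    using M by (simp add: s_def field_simps)
  define \<sigma> where "\<sigma> = alg (synchronous_arrivals \<tau>)"
  have sched: "valid_schedule M N (synchronous_arrivals \<tau>) \<sigma>"
      "meets_deadlines M s N \<tau> (synchronous_arrivals \<tau>) \<sigma>"
    using alg[unfolded schedulable_by_def, rule_format, OF legal_synchronous_arrivals[OF assms(3)]]
    by (simp_all add: \<sigma>_def s_def)
  obtain n P where n: "Suc n \<le> N"
      and P: "dm_partition (arbitrary_deadline_test \<tau>) fit M n = Some P"
      and fails: "\<And>m. m \<in> {1..M} \<Longrightarrow> \<not> arbitrary_deadline_test \<tau> (P m) (Suc n)"
    using dm_partition_failure[OF assms(6)] by blast
  have sub: "P m \<subseteq> {1..n}" and dis: "disjoint_family P" for m
    using dm_partition_disjoint[OF P] by auto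
  define k where "k = Suc n"
  have k: "k \<in> {1..N}" using n by (simp add: k_def)
  note bounds = s assms(3,4) k sched
  let ?D = "deadline (\<tau> k)"
  let ?f = "\<lambda>i. wcet (\<tau> i) / ?D + utilization (\<tau> i)"
  define b where "b = max (wcet (\<tau> k) / ?D) (utilization (\<tau> k))"
  have D: "0 < ?D" by (rule deadline_pos[OF bounds])
  have C: "0 \<le> wcet (\<tau> i)" if "i \<in> {1..N}" for i
    using assms(3) that by (simp add: sporadic_task_def less_imp_le)
  have U: "0 \<le> utilization (\<tau> i)" if "i \<in> {1..N}" for i
    using assms(3) that by (simp add: utilization_nonneg)
  have f: "0 \<le> ?f i" if "i \<in> {1..N}" for i
    using C[OF that] U[OF that] D by simp
  have "real M * (1 - b) = (\<Sum>m=1..M. 1 - b)" by simp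
  also have "\<dots> < (\<Sum>m=1..M. \<Sum>i\<in>P m. ?f i)"
  proof (rule sum_strict_mono)
    fix m assume m: "m \<in> {1..M}"
    have "0 \<le> wcet (\<tau> i)" if "i \<in> P m" for i
      using that sub[of m] n by (intro C) auto
    then show "1 - b < (\<Sum>i\<in>P m. ?f i)"
      using test_failure_bound[of \<tau> k "P m"] D fails[OF m] unfolding b_def k_def by blast
  qed (use assms(1) in auto)
  also have "\<dots> = (\<Sum>i\<in>(\<Union>m\<in>{1..M}. P m). ?f i)"
  proof (rule sum.UNION_disjoint[symmetric])
    show "\<forall>m\<in>{1..M}. finite (P m)" using sub by (meson finite_atLeastAtMost finite_subset)
    show "\<forall>m\<in>{1..M}. \<forall>m'\<in>{1..M}. m \<noteq> m' \<longrightarrow> P m \<inter> P m' = {}"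
      using dis by (simp add: disjoint_family_on_def)
  qed simp
  also have "\<dots> \<le> (\<Sum>i=1..n. ?f i)"
  proof (rule sum_mono2)
    show "(\<Union>m\<in>{1..M}. P m) \<subseteq> {1..n}" using sub by blast
  qed (use n in \<open>simp_all add: f\<close>)
  also have "\<dots> = (\<Sum>i=1..k. ?f i) - ?f k"
    by (simp add: k_def)
  also have "\<dots> \<le> 2 * real M * s - b"
  proof -
    have "(\<Sum>i=1..k. wcet (\<tau> i)) / ?D \<le> real M * s"
      using sum_wcet_le[OF bounds] D by (simp add: field_simps)
    moreover have "(\<Sum>i=1..k. ?f i) = (\<Sum>i=1..k. wcet (\<tau> i)) / ?D + (\<Sum>i=1..k. utilization (\<tau> i))"
      by (simp add: sum.distrib sum_divide_distrib)
    \<comment> \<open>A maximum of two nonnegative numbers is at most their sum. Removing task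
      \<open>k\<close> from the total thus frees at least \<open>b\<close>, which is what yields the
      \<open>- 1 / real M\<close> in the factor.\<close>
    moreover have "b \<le> ?f k"
      using C[OF k] U[OF k] D by (simp add: b_def)
    ultimately show ?thesis using sum_utilization_le[OF bounds] by linarith
  qed
  finally have "real M < 2 * real M * s + (real M - 1) * b" by (simp add: algebra_simps)
  moreover have "b \<le> s"
    using density_le[OF bounds] utilization_le[OF bounds] by (simp add: b_def)
  \<comment> \<open>The coefficient of \<open>b\<close> is nonnegative, so \<open>b\<close> may be
    replaced by \<open>s\<close>, giving \<open>real M < (3 * real M - 1) * s\<close>.\<close>
  then have "(real M - 1) * b \<le> (real M - 1) * s" using M by (intro mult_left_mono) auto
  ultimately show False using sM by (simp add: algebra_simps)
qed

end
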